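(* Let $G$ be an infinite connected, locally finite graph with its path metric, let $k$ be its minimum degree, and let $G'=\{v\in G:\deg(v)=k\}$. If $G'$ is finite, then both $G$ and $\mathcal{K}(G)$ are plastic.
   Context: Graphs are simple, undirected and unweighted. A connected graph is identified with its vertex set and equipped with the path metric $d(u,v)$ = minimal length of a walk from $u$ to $v$. A graph is locally finite if every vertex has finite degree. For a metric space $X$, $\mathcal{K}(X)$ is the set of all nonempty compact subsets of $X$ with the Hausdorff metric; for such a graph, $\mathcal{K}(G)$ consists of the nonempty finite sets of vertices. A map $f$ is nonexpansive if $d(f(x),f(y))\le d(x,y)$ for all $x,y$. A metric space is plastic if every bijective nonexpansive self-map is an isometry. *)

theory Defs
  imports "HOL-Analysis.Analysis"
begin

section \<open>Simple graphs and their path metric\<close>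

text \<open>Edges are two-element sets of vertices, so \<open>{u, u} = {u}\<close> is never an edge.
  Vertex sets may be infinite.\<close>

definition simple_graph :: "'a set \<Rightarrow> 'a set set \<Rightarrow> bool" where
  "simple_graph V E \<longleftrightarrow> (\<forall>e\<in>E. e \<subseteq> V \<and> card e = 2)"

definition neighbours :: "'a set set \<Rightarrow> 'a \<Rightarrow> 'a set" where
  "neighbours E v = {u. {v, u} \<in> E}"

definition vertex_degree :: "'a set set \<Rightarrow> 'a \<Rightarrow> nat" where
  "vertex_degree E v = card (neighbours E v)"

definition locally_finite_graph :: "'a set \<Rightarrow> 'a set set \<Rightarrow> bool" where
  "locally_finite_graph V E \<longleftrightarrow> (\<forall>v\<in>V. finite (neighbours E v))"

text \<open>Since \<^const>\<open>card\<close> is \<open>0\<close> on infinite sets, the minimum degree is only meaningful for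
  locally finite graphs (with at least one vertex).\<close>

definition min_degree :: "'a set \<Rightarrow> 'a set set \<Rightarrow> nat" where
  "min_degree V E = (LEAST k. \<exists>v\<in>V. vertex_degree E v = k)"

text \<open>A walk is given by its nonempty list of vertices; its length, the number of edges
  traversed, is one less than the length of that list.\<close>

definition walk :: "'a set \<Rightarrow> 'a set set \<Rightarrow> 'a list \<Rightarrow> bool" where
  "walk V E xs \<longleftrightarrow> xs \<noteq> [] \<and> set xs \<subseteq> V \<and> successively (\<lambda>u v. {u, v} \<in> E) xs"

definition connected_graph :: "'a set \<Rightarrow> 'a set set \<Rightarrow> bool" where
  "connected_graph V E \<longleftrightarrow> (\<forall>u\<in>V. \<forall>v\<in>V. \<exists>xs. walk V E xs \<and> hd xs = u \<and> last xs = v)"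

definition path_dist :: "'a set \<Rightarrow> 'a set set \<Rightarrow> 'a \<Rightarrow> 'a \<Rightarrow> nat" where
  "path_dist V E u v =
     (LEAST n. \<exists>xs. walk V E xs \<and> hd xs = u \<and> last xs = v \<and> length xs = Suc n)"

definition graph_metric :: "'a set \<Rightarrow> 'a set set \<Rightarrow> 'a metric" where
  "graph_metric V E = metric (V, \<lambda>u v. real (path_dist V E u v))"


section \<open>The hyperspace of nonempty compact subsets\<close>

definition nonempty_compacts :: "'a metric \<Rightarrow> 'a set set" where
  "nonempty_compacts m = {A. A \<noteq> {} \<and> compactin (mtopology_of m) A}"

definition hausdorff_dist :: "'a metric \<Rightarrow> 'a set \<Rightarrow> 'a set \<Rightarrow> real" where
  "hausdorff_dist m A B =
     max (SUP a\<in>A. INF b\<in>B. mdist m a b) (SUP b\<in>B. INF a\<in>A. mdist m a b)"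

text \<open>The value \<open>0\<close> off the carrier is a dummy: a \<^locale>\<open>Metric_space\<close> must have a
  nonnegative distance everywhere.\<close>

definition hausdorff_metric :: "'a metric \<Rightarrow> 'a set metric" where
  "hausdorff_metric m = metric (nonempty_compacts m,
     \<lambda>A B. if A \<in> nonempty_compacts m \<and> B \<in> nonempty_compacts m
           then hausdorff_dist m A B else 0)"


section \<open>Plastic metric spaces\<close>

definition nonexpansive :: "'a metric \<Rightarrow> ('a \<Rightarrow> 'a) \<Rightarrow> bool" where
  "nonexpansive m f \<longleftrightarrow>
     (\<forall>x\<in>mspace m. \<forall>y\<in>mspace m. mdist m (f x) (f y) \<le> mdist m x y)"

definition plastic :: "'a metric \<Rightarrow> bool" where
  "plastic m \<longleftrightarrow> (\<forall>f. bij_betw f (mspace m) (mspace m) \<and> nonexpansive m f \<longrightarrow>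
     (\<forall>x\<in>mspace m. \<forall>y\<in>mspace m. mdist m (f x) (f y) = mdist m x y))"


section \<open>The metrics above are genuine\<close>

text \<open>The function \<^const>\<open>metric\<close> is unspecified on pairs that do not form a metric space, so
  the following facts are needed to know that \<^const>\<open>graph_metric\<close> and
  \<^const>\<open>hausdorff_metric\<close> have the intended carriers and distances.\<close>

lemma walk_rev: "walk V E xs \<Longrightarrow> walk V E (rev xs)"
  by (simp add: walk_def insert_commute)

lemma walk_append:
  assumes "walk V E xs" "walk V E ys" "last xs = hd ys"
  shows "walk V E (xs @ tl ys)"
proof (cases ys)
  case (Cons y zs)
  then show ?thesis
    using assms by (cases zs) (auto simp: walk_def successively_append_iff)
qed (use assms in \<open>auto simp: walk_def\<close>)

lemma path_dist_le:
  assumes "walk V E xs" "hd xs = u" "last xs = v"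
  shows "path_dist V E u v \<le> length xs - 1"
proof -
  have "length xs = Suc (length xs - 1)"
    using assms by (cases xs) (auto simp: walk_def)
  then show ?thesis
    unfolding path_dist_def using assms by (intro Least_le) blast
qed

lemma path_dist_walk:
  assumes "connected_graph V E" "u \<in> V" "v \<in> V"
  obtains xs where "walk V E xs" "hd xs = u" "last xs = v" "length xs = Suc (path_dist V E u v)"
proof -
  obtain xs where xs: "walk V E xs" "hd xs = u" "last xs = v"
    using assms by (auto simp: connected_graph_def)
  then have "length xs = Suc (length xs - 1)"
    by (cases xs) (auto simp: walk_def)
  with xs have "\<exists>n xs. walk V E xs \<and> hd xs = u \<and> last xs = v \<and> length xs = Suc n"
    by blast
  from LeastI_ex[OF this] show ?thesis
    using that unfolding path_dist_def by blast
qed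

lemma Metric_space_path_dist:
  assumes "connected_graph V E"
  shows "Metric_space V (\<lambda>u v. real (path_dist V E u v))"
proof
  fix u v
  have "(\<exists>xs. walk V E xs \<and> hd xs = u \<and> last xs = v \<and> length xs = Suc n) \<longleftrightarrow>
        (\<exists>xs. walk V E xs \<and> hd xs = v \<and> last xs = u \<and> length xs = Suc n)" for n
    by (metis walk_rev hd_rev last_rev length_rev)
  then show "real (path_dist V E u v) = real (path_dist V E v u)"
    by (simp add: path_dist_def)
next
  fix u v assume uv: "u \<in> V" "v \<in> V"
  show "real (path_dist V E u v) = 0 \<longleftrightarrow> u = v"
  proof
    assume "real (path_dist V E u v) = 0"
    then obtain xs where "hd xs = u" "last xs = v" "length xs = Suc 0"
      using path_dist_walk[OF assms uv] by auto
    then show "u = v"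
      by (cases xs) auto
  next
    assume "u = v"
    then show "real (path_dist V E u v) = 0"
      using path_dist_le[of V E "[u]" u v] uv by (simp add: walk_def)
  qed
next
  fix u v w assume V: "u \<in> V" "v \<in> V" "w \<in> V"
  obtain xs where xs: "walk V E xs" "hd xs = u" "last xs = v"
      "length xs = Suc (path_dist V E u v)"
    using path_dist_walk[OF assms V(1,2)] .
  obtain ys where ys: "walk V E ys" "hd ys = v" "last ys = w"
      "length ys = Suc (path_dist V E v w)"
    using path_dist_walk[OF assms V(2,3)] .
  have w: "walk V E (xs @ tl ys)"
    using walk_append xs ys by metis
  have "hd (xs @ tl ys) = u"
    using xs by (auto simp: walk_def)
  moreover have "last (xs @ tl ys) = w"
    using xs ys by (cases ys) (auto simp: walk_def)
  ultimately have "path_dist V E u w \<le> length (xs @ tl ys) - 1"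
    using path_dist_le w by metis
  also have "\<dots> = path_dist V E u v + path_dist V E v w"
    using xs ys by simp
  finally show "real (path_dist V E u w) \<le> real (path_dist V E u v) + real (path_dist V E v w)"
    by linarith
qed simp

lemma mspace_graph_metric [simp]:
  "connected_graph V E \<Longrightarrow> mspace (graph_metric V E) = V"
  by (simp add: graph_metric_def Metric_space.mspace_metric[OF Metric_space_path_dist])

lemma mdist_graph_metric [simp]:
  "connected_graph V E \<Longrightarrow> mdist (graph_metric V E) u v = real (path_dist V E u v)"
  by (simp add: graph_metric_def Metric_space.mdist_metric[OF Metric_space_path_dist])

lemma nonempty_compacts_graph_metric:
  assumes "connected_graph V E"
  shows "nonempty_compacts (graph_metric V E) = {A. A \<noteq> {} \<and> finite A \<and> A \<subseteq> V}"
proof -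
  interpret Metric_space V "\<lambda>u v. real (path_dist V E u v)"
    by (rule Metric_space_path_dist[OF assms])
  have "openin mtopology {v}" if "v \<in> V" for v
  proof -
    have "mball v 1 = {v}"
      using that zero[of v] by (auto simp: in_mball)
    then show ?thesis
      by (metis openin_mball)
  qed
  then have "discrete_topology V = mtopology"
    by (simp add: discrete_topology_unique)
  then have "mtopology_of (graph_metric V E) = discrete_topology V"
    by (simp add: graph_metric_def)
  then show ?thesis
    by (auto simp: nonempty_compacts_def compactin_discrete_topology)
qed

context
  fixes m :: "'a metric"
begin

interpretation Metric_space "mspace m" "mdist m"
  by simp

private definition excess :: "'a set \<Rightarrow> 'a set \<Rightarrow> real" where
  "excess A B = (SUP a\<in>A. INF b\<in>B. mdist m a b)"

private lemma hausdorff_dist_excess: "hausdorff_dist m A B = max (excess A B) (excess B A)"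
  by (simp add: hausdorff_dist_def excess_def commute)

private lemma compacts_subset: "A \<in> nonempty_compacts m \<Longrightarrow> A \<subseteq> mspace m"
  using compactin_subset_topspace by (fastforce simp: nonempty_compacts_def)

private lemma inf_le: "b \<in> B \<Longrightarrow> (INF b\<in>B. mdist m a b) \<le> mdist m a b"
  by (rule cINF_lower) (auto intro: bdd_belowI[of _ 0])

private lemma inf_ge0: "B \<noteq> {} \<Longrightarrow> 0 \<le> (INF b\<in>B. mdist m a b)"
  by (rule cINF_greatest) auto

private lemma inf_le_excess:
  assumes A: "A \<in> nonempty_compacts m" and B: "B \<in> nonempty_compacts m" and a: "a \<in> A"
  shows "(INF b\<in>B. mdist m a b) \<le> excess A B"
proof -
  obtain b where b: "b \<in> B"
    using B by (auto simp: nonempty_compacts_def)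
  have "mbounded A"
    using A by (auto simp: nonempty_compacts_def mtopology_of_def intro: compactin_imp_mbounded)
  then obtain r where r: "\<And>x. x \<in> A \<Longrightarrow> mdist m a x \<le> r"
    using a by (auto simp: mbounded_alt)
  have "(INF b\<in>B. mdist m x b) \<le> r + mdist m a b" if "x \<in> A" for x
  proof -
    have "mdist m x b \<le> mdist m x a + mdist m a b"
      using that a b compacts_subset A B by (meson subsetD triangle)
    then show ?thesis
      using inf_le[OF b, of x] r[OF that] commute[of x a] by linarith
  qed
  then have "bdd_above ((\<lambda>x. INF b\<in>B. mdist m x b) ` A)"
    by (rule bdd_aboveI2)
  then show ?thesis
    unfolding excess_def using a by (rule cSUP_upper[rotated])
qed

private lemma excess_ge0:
  assumes "A \<in> nonempty_compacts m" "B \<in> nonempty_compacts m"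
  shows "0 \<le> excess A B"
proof -
  obtain a where "a \<in> A"
    using assms by (auto simp: nonempty_compacts_def)
  then show ?thesis
    using inf_le_excess[OF assms] inf_ge0[of B a] assms by (force simp: nonempty_compacts_def)
qed

private lemma excess_triangle:
  assumes A: "A \<in> nonempty_compacts m" and B: "B \<in> nonempty_compacts m"
    and C: "C \<in> nonempty_compacts m"
  shows "excess A C \<le> excess A B + excess B C"
proof -
  have ne: "A \<noteq> {}" "B \<noteq> {}" "C \<noteq> {}"
    using A B C by (auto simp: nonempty_compacts_def)
  have "(INF c\<in>C. mdist m a c) \<le> excess A B + excess B C" if a: "a \<in> A" for a
  proof -
    have "(INF c\<in>C. mdist m a c) - excess B C \<le> mdist m a b" if b: "b \<in> B" for b
    proof -
      have "(INF c\<in>C. mdist m a c) - mdist m a b \<le> mdist m b c" if c: "c \<in> C" for c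
      proof -
        have "mdist m a c \<le> mdist m a b + mdist m b c"
          using a b c compacts_subset A B C by (meson subsetD triangle)
        then show ?thesis
          using inf_le[OF c, of a] by linarith
      qed
      then have "(INF c\<in>C. mdist m a c) - mdist m a b \<le> (INF c\<in>C. mdist m b c)"
        by (intro cINF_greatest ne)
      then show ?thesis
        using inf_le_excess[OF B C b] by linarith
    qed
    then have "(INF c\<in>C. mdist m a c) - excess B C \<le> (INF b\<in>B. mdist m a b)"
      by (intro cINF_greatest ne)
    then show ?thesis
      using inf_le_excess[OF A B a] by linarith
  qed
  then show ?thesis
    unfolding excess_def[of A C] by (intro cSUP_least ne)
qed

private lemma excess_zero_subset:
  assumes A: "A \<in> nonempty_compacts m" and B: "B \<in> nonempty_compacts m"
    and "excess A B \<le> 0"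
  shows "A \<subseteq> B"
proof
  fix a assume a: "a \<in> A"
  have ne: "B \<noteq> {}"
    using B by (auto simp: nonempty_compacts_def)
  have "closedin mtopology B"
    using B by (auto simp: nonempty_compacts_def mtopology_of_def
        intro: compactin_imp_closedin Hausdorff_space_mtopology)
  have "\<exists>b\<in>B. mdist m a b < r" if "r > 0" for r
  proof (rule ccontr)
    assume "\<not> ?thesis"
    then have "r \<le> (INF b\<in>B. mdist m a b)"
      by (intro cINF_greatest ne) force
    then show False
      using inf_le_excess[OF A B a] assms(3) that by linarith
  qed
  then have "a \<in> mtopology closure_of B"
    using a compacts_subset[OF A] compacts_subset[OF B]
    by (fastforce simp: metric_closure_of)
  then show "a \<in> B"
    using \<open>closedin mtopology B\<close> by (simp add: closure_of_closedin)
qed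

private lemma excess_self:
  assumes A: "A \<in> nonempty_compacts m"
  shows "excess A A = 0"
proof -
  have ne: "A \<noteq> {}"
    using A by (auto simp: nonempty_compacts_def)
  have "(INF b\<in>A. mdist m a b) \<le> 0" if "a \<in> A" for a
    using inf_le[OF that, of a] that compacts_subset[OF A] by auto
  then have "excess A A \<le> 0"
    unfolding excess_def by (intro cSUP_least ne)
  then show ?thesis
    using excess_ge0[OF A A] by linarith
qed

lemma Metric_space_hausdorff:
  "Metric_space (nonempty_compacts m)
     (\<lambda>A B. if A \<in> nonempty_compacts m \<and> B \<in> nonempty_compacts m
            then hausdorff_dist m A B else 0)"
proof
  fix A B :: "'a set"
  show "0 \<le> (if A \<in> nonempty_compacts m \<and> B \<in> nonempty_compacts m
            then hausdorff_dist m A B else 0)"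
    using excess_ge0[of A B] by (auto simp: hausdorff_dist_excess max_def)
  show "(if A \<in> nonempty_compacts m \<and> B \<in> nonempty_compacts m
            then hausdorff_dist m A B else 0) =
        (if B \<in> nonempty_compacts m \<and> A \<in> nonempty_compacts m
            then hausdorff_dist m B A else 0)"
    by (auto simp: hausdorff_dist_excess max.commute)
next
  fix A B assume AB: "A \<in> nonempty_compacts m" "B \<in> nonempty_compacts m"
  have "hausdorff_dist m A B = 0 \<longleftrightarrow> A = B"
  proof
    assume "hausdorff_dist m A B = 0"
    then have "excess A B \<le> 0" "excess B A \<le> 0"
      unfolding hausdorff_dist_excess by linarith+
    then show "A = B"
      using excess_zero_subset AB by blast
  qed (use AB excess_self in \<open>simp add: hausdorff_dist_excess\<close>)
  then show "(if A \<in> nonempty_compacts m \<and> B \<in> nonempty_compacts m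
            then hausdorff_dist m A B else 0) = 0 \<longleftrightarrow> A = B"
    using AB by simp
next
  fix A B C
  assume ABC: "A \<in> nonempty_compacts m" "B \<in> nonempty_compacts m" "C \<in> nonempty_compacts m"
  have "hausdorff_dist m A C \<le> hausdorff_dist m A B + hausdorff_dist m B C"
    using excess_triangle[of A B C] excess_triangle[of C B A] ABC
    unfolding hausdorff_dist_excess by linarith
  then show "(if A \<in> nonempty_compacts m \<and> C \<in> nonempty_compacts m
            then hausdorff_dist m A C else 0) \<le>
        (if A \<in> nonempty_compacts m \<and> B \<in> nonempty_compacts m
            then hausdorff_dist m A B else 0) +
        (if B \<in> nonempty_compacts m \<and> C \<in> nonempty_compacts m
            then hausdorff_dist m B C else 0)"
    using ABC by simp
qed

lemma mspace_hausdorff_metric [simp]: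
  "mspace (hausdorff_metric m) = nonempty_compacts m"
  by (simp add: hausdorff_metric_def Metric_space.mspace_metric[OF Metric_space_hausdorff])

lemma mdist_hausdorff_metric:
  "A \<in> nonempty_compacts m \<Longrightarrow> B \<in> nonempty_compacts m \<Longrightarrow>
     mdist (hausdorff_metric m) A B = hausdorff_dist m A B"
  by (simp add: hausdorff_metric_def Metric_space.mdist_metric[OF Metric_space_hausdorff])

end

end

theory Submission
  imports Defs
begin

text \<open>
  Let \<open>f\<close> be a nonexpansive bijection of a metric space in which closed balls are finite. Being
  injective, \<open>f\<close> sends the ball of radius \<open>r\<close> about \<open>x\<close> into the ball of radius \<open>r\<close> about \<open>f x\<close>, so
  the number of points in balls of radius \<open>r\<close> can only grow along \<open>f\<close>. If the set \<open>S\<close> of the points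
  whose \<open>r\<close>-ball has at most \<open>n\<close> elements is finite and nonempty, then \<open>f\<close> permutes \<open>S\<close>, and it
  therefore permutes each of the finite neighbourhoods of \<open>S\<close>. On such a neighbourhood \<open>f\<close> also
  permutes the pairs of points, hence preserves the sum of all distances; as no distance grows, none
  can shrink. The neighbourhoods of \<open>S\<close> exhaust the space, so \<open>f\<close> is an isometry
  (\<open>plastic_if_finite_small_balls\<close>).

  Both halves of the theorem are instances of this with \<open>r = 1\<close>. In the graph the unit ball about \<open>v\<close>
  is the closed neighbourhood \<open>N[v]\<close>, with \<open>deg v + 1\<close> elements, and the smallest ones belong to the
  vertices of minimum degree \<open>k\<close>. In the hyperspace the unit ball about \<open>A\<close> consists of the subsets
  of \<open>\<Union>a\<in>A. N[a]\<close> that meet every \<open>N[a]\<close>. About \<open>{v}\<close> there are \<open>2 ^ (deg v + 1) - 1\<close> of them, which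
  is \<open>2 ^ (k + 1) - 1\<close> if \<open>v\<close> has minimum degree. A count of hitting sets (\<open>few_hitting_sets\<close>) shows
  that \<open>A\<close> has more than \<open>2 ^ (k + 1) - 1\<close> of them as soon as it contains a vertex of larger degree,
  so only subsets of the finite set of vertices of minimum degree remain.
\<close>


section \<open>A plasticity criterion for metric spaces with finite balls\<close>

text \<open>The sum of all distances within a neighbourhood of \<open>S\<close> is the invariant that turns
  \<open>\<le>\<close> into \<open>=\<close>.\<close>

lemma isometry_if_finite_invariant_set:
  assumes fin: "\<And>x r. x \<in> mspace m \<Longrightarrow> finite (mcball_of m x r)"
    and bij: "bij_betw f (mspace m) (mspace m)"
    and nonexp: "nonexpansive m f"
    and S: "finite S" "S \<noteq> {}" "S \<subseteq> mspace m" "f ` S \<subseteq> S"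
    and xy: "x \<in> mspace m" "y \<in> mspace m"
  shows "mdist m (f x) (f y) = mdist m x y"
proof -
  obtain p where p: "p \<in> S"
    using S by blast
  define r where "r = max (mdist m p x) (mdist m p y)"
  define B where "B = (\<Union>s\<in>S. mcball_of m s r)"
  have sub: "B \<subseteq> mspace m"
    by (auto simp: B_def)
  have finB: "finite B"
    unfolding B_def using S fin by blast
  have xyB: "x \<in> B" "y \<in> B"
    using p xy S by (auto simp: B_def r_def)
  have maps: "f z \<in> mspace m" if "z \<in> mspace m" for z
    using bij that by (auto simp: bij_betw_def)
  have "f z \<in> B" if "z \<in> B" for z
  proof -
    obtain s where s: "s \<in> S" "z \<in> mspace m" "mdist m s z \<le> r"
      using \<open>z \<in> B\<close> by (auto simp: B_def)
    moreover have "mdist m (f s) (f z) \<le> mdist m s z"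
      using nonexp s S by (auto simp: nonexpansive_def)
    moreover have "f s \<in> S"
      using s S by auto
    ultimately have "f z \<in> mcball_of m (f s) r"
      using maps S by auto
    with \<open>f s \<in> S\<close> show ?thesis
      unfolding B_def by blast
  qed
  moreover have inj: "inj_on f B"
    using bij sub by (auto simp: bij_betw_def intro: inj_on_subset)
  ultimately have "bij_betw f B B"
    using endo_inj_surj[OF finB, of f] by (auto simp: bij_betw_def)
  then have "bij_betw (map_prod f f) (B \<times> B) (B \<times> B)"
    by (intro bij_betw_map_prod)
  from sum.reindex_bij_betw[OF this, of "\<lambda>(a, b). mdist m a b"]
  have eq: "(\<Sum>z\<in>B \<times> B. mdist m (f (fst z)) (f (snd z))) = (\<Sum>z\<in>B \<times> B. mdist m (fst z) (snd z))"
    by (simp add: case_prod_beta)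
  have le: "mdist m (f (fst z)) (f (snd z)) \<le> mdist m (fst z) (snd z)" if "z \<in> B \<times> B" for z
    using nonexp sub that by (auto simp: nonexpansive_def subset_iff)
  have "(x, y) \<in> B \<times> B" "finite (B \<times> B)"
    using xyB finB by auto
  from sum_mono_inv[OF eq le this] show ?thesis
    by simp
qed

lemma card_mcball_le_image:
  assumes fin: "\<And>x. x \<in> mspace m \<Longrightarrow> finite (mcball_of m x r)"
    and bij: "bij_betw f (mspace m) (mspace m)"
    and nonexp: "nonexpansive m f"
    and x: "x \<in> mspace m"
  shows "card (mcball_of m x r) \<le> card (mcball_of m (f x) r)"
proof (rule card_inj_on_le)
  show "inj_on f (mcball_of m x r)"
    using bij by (auto simp: bij_betw_def inj_on_def)
  show "f ` mcball_of m x r \<subseteq> mcball_of m (f x) r"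
    using bij nonexp x by (fastforce simp: bij_betw_def nonexpansive_def)
  show "finite (mcball_of m (f x) r)"
    using fin bij x by (auto simp: bij_betw_def)
qed

text \<open>The inverse of \<open>f\<close> maps the finite set of the points with small balls into itself, so it
  permutes this set, and so does \<open>f\<close>.\<close>

theorem plastic_if_finite_small_balls:
  assumes fin: "\<And>x r. x \<in> mspace m \<Longrightarrow> finite (mcball_of m x r)"
    and small: "finite {x \<in> mspace m. card (mcball_of m x r) \<le> n}"
      "{x \<in> mspace m. card (mcball_of m x r) \<le> n} \<noteq> {}"
  shows "plastic m"
  unfolding plastic_def
proof (intro allI impI, elim conjE)
  fix f
  assume bij: "bij_betw f (mspace m) (mspace m)" and nonexp: "nonexpansive m f"
  define S where "S = {x \<in> mspace m. card (mcball_of m x r) \<le> n}"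
  define g where "g = inv_into (mspace m) f"
  have g: "bij_betw g (mspace m) (mspace m)"
    unfolding g_def by (rule bij_betw_inv_into[OF bij])
  have fg: "f (g y) = y" if "y \<in> mspace m" for y
    unfolding g_def using bij that by (simp add: bij_betw_inv_into_right)
  have "g y \<in> S" if y: "y \<in> S" for y
  proof -
    have "g y \<in> mspace m"
      using y bij_betwE[OF g] by (auto simp: S_def)
    moreover from this have "card (mcball_of m (g y) r) \<le> card (mcball_of m (f (g y)) r)"
      by (intro card_mcball_le_image fin bij nonexp)
    ultimately show ?thesis
      using y fg by (auto simp: S_def)
  qed
  moreover have "inj_on g S"
    using g by (auto simp: S_def bij_betw_def intro: inj_on_subset)
  ultimately have "g ` S = S"
    using small by (intro endo_inj_surj) (auto simp: S_def)
  have "S \<subseteq> mspace m"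
    by (auto simp: S_def)
  have "f ` S \<subseteq> S"
  proof
    fix z assume "z \<in> f ` S"
    then have "z \<in> f ` g ` S"
      by (simp only: \<open>g ` S = S\<close>)
    then obtain y where "y \<in> S" "z = f (g y)"
      by blast
    with fg \<open>S \<subseteq> mspace m\<close> show "z \<in> S"
      by auto
  qed
  then show "\<forall>x\<in>mspace m. \<forall>y\<in>mspace m. mdist m (f x) (f y) = mdist m x y"
    using small by (intro ballI isometry_if_finite_invariant_set[OF fin bij nonexp, of S])
      (auto simp: S_def)
qed


section \<open>Counting hitting sets\<close>

text \<open>Let \<open>X\<close> be a member of least size. A nonempty subset of \<open>X\<close> together with all of \<open>\<Union>F - X\<close> is
  a hitting set: a member that is not contained in \<open>X\<close> meets \<open>\<Union>F - X\<close>, and one that is contained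
  in \<open>X\<close> equals \<open>X\<close>. This gives at least \<open>2 ^ q - 1\<close> hitting sets, and \<open>2 ^ (q + 1) - 1\<close> of them if \<open>X\<close>
  has more than \<open>q\<close> elements. If \<open>X\<close> has exactly \<open>q\<close> elements but another member has more, that member
  has a point \<open>z\<close> outside \<open>X\<close>, and \<open>\<Union>F - {z}\<close> is one further hitting set, because members have at
  least two elements.\<close>

lemma few_hitting_sets:
  assumes finF: "finite (\<Union>F)"
    and q: "2 \<le> q" "\<And>X. X \<in> F \<Longrightarrow> q \<le> card X"
    and few: "card {B. B \<subseteq> \<Union>F \<and> (\<forall>X\<in>F. B \<inter> X \<noteq> {})} < 2 ^ q"
    and Y: "Y \<in> F"
  shows "card Y = q"
proof (rule ccontr)
  assume "card Y \<noteq> q"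
  then have Yq: "q < card Y"
    using q(2)[OF Y] by linarith
  define H where "H = {B. B \<subseteq> \<Union>F \<and> (\<forall>X\<in>F. B \<inter> X \<noteq> {})}"
  have finH: "finite H"
    unfolding H_def using finF by auto
  have fin: "finite X" if "X \<in> F" for X
    using finF that by (meson Union_upper finite_subset)
  obtain X where X: "X \<in> F" and least: "\<And>Z. Z \<in> F \<Longrightarrow> card X \<le> card Z"
    using ex_has_least_nat[of "\<lambda>Z. Z \<in> F" Y card] Y by blast
  define C where "C = (\<lambda>S. S \<union> (\<Union>F - X)) ` (Pow X - {{}})"
  have "inj_on (\<lambda>S. S \<union> (\<Union>F - X)) (Pow X - {{}})"
    by (auto simp: inj_on_def)
  then have cardC: "card C = 2 ^ card X - 1"
    using fin[OF X] by (simp add: C_def card_image card_Diff_singleton card_Pow)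
  have "C \<subseteq> H"
  proof
    fix B assume "B \<in> C"
    then obtain S where S: "S \<subseteq> X" "S \<noteq> {}" and B: "B = S \<union> (\<Union>F - X)"
      by (auto simp: C_def)
    have "B \<inter> Z \<noteq> {}" if Z: "Z \<in> F" for Z
    proof (cases "Z \<subseteq> X")
      case True
      then have "Z = X"
        using least[OF Z] fin[OF X] by (simp add: card_seteq)
      then show ?thesis
        using S B by auto
    next
      case False
      then show ?thesis
        using Z B by auto
    qed
    then show "B \<in> H"
      using S X B by (auto simp: H_def)
  qed
  have "2 ^ q \<le> card H"
  proof (cases "card X = q")
    case True
    obtain z where z: "z \<in> Y" "z \<notin> X"
      using Yq True card_mono[OF fin[OF X], of Y] by (metis linorder_not_less subsetI)
    have "(\<Union>F - {z}) \<inter> Z \<noteq> {}" if Z: "Z \<in> F" for Z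
    proof
      assume "(\<Union>F - {z}) \<inter> Z = {}"
      then have "Z \<subseteq> {z}"
        using Z by auto
      then have "card Z \<le> 1"
        using card_mono[of "{z}" Z] by simp
      then show False
        using q(1) q(2)[OF Z] by linarith
    qed
    then have "\<Union>F - {z} \<in> H"
      by (auto simp: H_def)
    moreover have "\<Union>F - {z} \<notin> C"
      using z Y by (auto simp: C_def)
    ultimately have "card C < card H"
      using \<open>C \<subseteq> H\<close> finH by (intro psubset_card_mono) auto
    then show ?thesis
      using cardC True by simp
  next
    case False
    then have "Suc q \<le> card X"
      using q(2)[OF X] by simp
    then have "(2::nat) ^ Suc q \<le> 2 ^ card X"
      by (rule power_increasing) simp
    moreover have "card C \<le> card H"
      using \<open>C \<subseteq> H\<close> finH by (rule card_mono[rotated])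
    moreover have "(1::nat) \<le> 2 ^ q"
      by simp
    ultimately show ?thesis
      unfolding cardC power_Suc by linarith
  qed
  then show False
    using few by (simp add: H_def)
qed


section \<open>Balls in a connected graph\<close>

definition closed_neighbourhood :: "'a set set \<Rightarrow> 'a \<Rightarrow> 'a set" where
  "closed_neighbourhood E v = insert v (neighbours E v)"

lemma closed_neighbourhood_subset:
  "simple_graph V E \<Longrightarrow> v \<in> V \<Longrightarrow> closed_neighbourhood E v \<subseteq> V"
  by (auto simp: simple_graph_def closed_neighbourhood_def neighbours_def)

lemma card_closed_neighbourhood:
  assumes "simple_graph V E" "locally_finite_graph V E" "v \<in> V"
  shows "card (closed_neighbourhood E v) = Suc (vertex_degree E v)"
proof -
  have "v \<notin> neighbours E v"
    using assms(1) by (force simp: simple_graph_def neighbours_def)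
  then show ?thesis
    using assms by (simp add: closed_neighbourhood_def vertex_degree_def locally_finite_graph_def)
qed

text \<open>The next-to-last vertex of a shortest walk.\<close>

lemma path_dist_Suc_obtain:
  assumes "connected_graph V E" "u \<in> V" "v \<in> V" "path_dist V E u v = Suc n"
  obtains w where "w \<in> V" "path_dist V E u w \<le> n" "v \<in> neighbours E w"
proof -
  obtain xs where xs: "walk V E xs" "hd xs = u" "last xs = v" "length xs = Suc (Suc n)"
    using path_dist_walk[OF assms(1-3)] assms(4) by metis
  obtain ys where "xs = ys @ [v]" "length ys = Suc n"
    using xs(3,4) by (cases xs rule: rev_cases) auto
  then have ys: "xs = ys @ [v]" "length ys = Suc n" "ys \<noteq> []"
    by auto
  have "walk V E ys" "{last ys, v} \<in> E" "last ys \<in> V"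
    using xs(1) ys by (auto simp: walk_def successively_append_iff)
  moreover have "path_dist V E u (last ys) \<le> n"
    using path_dist_le[of V E ys] \<open>walk V E ys\<close> xs(2) ys by simp
  ultimately show ?thesis
    using that by (auto simp: neighbours_def)
qed

lemma path_dist_le_1_iff:
  assumes "simple_graph V E" "connected_graph V E" "u \<in> V" "v \<in> V"
  shows "path_dist V E u v \<le> 1 \<longleftrightarrow> v \<in> closed_neighbourhood E u"
proof -
  have zero: "path_dist V E u w = 0 \<longleftrightarrow> u = w" if "w \<in> V" for w
    using Metric_space.zero[OF Metric_space_path_dist[OF assms(2)] assms(3) that] by simp
  show ?thesis
  proof
    assume le: "path_dist V E u v \<le> 1"
    show "v \<in> closed_neighbourhood E u"
    proof (cases "path_dist V E u v")
      case 0
      then show ?thesis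
        using zero[OF assms(4)] by (simp add: closed_neighbourhood_def)
    next
      case (Suc n)
      with le have "path_dist V E u v = Suc 0"
        by simp
      from path_dist_Suc_obtain[OF assms(2-4) this] show ?thesis
        using zero by (auto simp: closed_neighbourhood_def)
    qed
  next
    assume v: "v \<in> closed_neighbourhood E u"
    show "path_dist V E u v \<le> 1"
    proof (cases "u = v")
      case True
      then show ?thesis
        using zero[OF assms(4)] by simp
    next
      case False
      then have "walk V E [u, v]"
        using v assms by (auto simp: walk_def closed_neighbourhood_def neighbours_def)
      from path_dist_le[OF this] show ?thesis
        by simp
    qed
  qed
qed

lemma mcball_graph_metric_1:
  assumes "simple_graph V E" "connected_graph V E" "v \<in> V"
  shows "mcball_of (graph_metric V E) v 1 = closed_neighbourhood E v"
  using assms path_dist_le_1_iff[OF assms(1,2,3)] closed_neighbourhood_subset[OF assms(1,3)]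
  by auto

lemma finite_mcball_graph_metric:
  assumes "connected_graph V E" "locally_finite_graph V E" "v \<in> V"
  shows "finite (mcball_of (graph_metric V E) v r)"
proof -
  have "finite {u \<in> V. path_dist V E v u \<le> n}" for n
  proof (induction n)
    case 0
    have "{u \<in> V. path_dist V E v u \<le> 0} \<subseteq> {v}"
      using Metric_space.zero[OF Metric_space_path_dist[OF assms(1)] assms(3)] by auto
    then show ?case
      by (rule finite_subset) simp
  next
    case (Suc n)
    let ?B = "{u \<in> V. path_dist V E v u \<le> n}"
    have "{u \<in> V. path_dist V E v u \<le> Suc n} \<subseteq> ?B \<union> (\<Union>w\<in>?B. neighbours E w)"
    proof
      fix u assume "u \<in> {u \<in> V. path_dist V E v u \<le> Suc n}"
      then consider "u \<in> ?B" | "u \<in> V" "path_dist V E v u = Suc n"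
        by (auto simp: le_Suc_eq)
      then show "u \<in> ?B \<union> (\<Union>w\<in>?B. neighbours E w)"
      proof cases
        case 2
        from path_dist_Suc_obtain[OF assms(1,3) this] show ?thesis
          by blast
      qed simp
    qed
    moreover have "finite (?B \<union> (\<Union>w\<in>?B. neighbours E w))"
      using Suc assms(2) by (auto simp: locally_finite_graph_def)
    ultimately show ?case
      by (rule finite_subset)
  qed
  then have "finite {u \<in> V. path_dist V E v u \<le> nat \<lfloor>r\<rfloor>}" .
  moreover have "mcball_of (graph_metric V E) v r \<subseteq> {u \<in> V. path_dist V E v u \<le> nat \<lfloor>r\<rfloor>}"
    using assms(1) by (auto simp: le_nat_floor)
  ultimately show ?thesis
    by (rule finite_subset[rotated])
qed

lemma vertex_degree_pos:
  assumes "infinite V" "connected_graph V E" "locally_finite_graph V E" "v \<in> V"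
  shows "0 < vertex_degree E v"
proof -
  obtain w where w: "w \<in> V" "w \<noteq> v"
    using assms(1) finite_subset[of V "{v}"] by auto
  then have "path_dist V E w v \<noteq> 0"
    using Metric_space.zero[OF Metric_space_path_dist[OF assms(2)] w(1) assms(4)] by simp
  then obtain n where "path_dist V E w v = Suc n"
    using not0_implies_Suc by blast
  from path_dist_Suc_obtain[OF assms(2) w(1) assms(4) this]
  obtain u where "v \<in> neighbours E u" .
  then have "u \<in> neighbours E v"
    by (simp add: neighbours_def insert_commute)
  then show ?thesis
    using assms(3,4) by (auto simp: vertex_degree_def locally_finite_graph_def card_gt_0_iff)
qed

lemma min_degree_le:
  "v \<in> V \<Longrightarrow> min_degree V E \<le> vertex_degree E v"
  unfolding min_degree_def by (rule Least_le) blast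

lemma min_degree_attained:
  assumes "V \<noteq> {}"
  obtains v where "v \<in> V" "vertex_degree E v = min_degree V E"
proof -
  have "\<exists>k. \<exists>v\<in>V. vertex_degree E v = k"
    using assms by blast
  from LeastI_ex[OF this] show ?thesis
    using that unfolding min_degree_def by blast
qed


section \<open>Balls in the hyperspace of a connected graph\<close>

lemma hausdorff_dist_le_iff:
  assumes "finite A" "A \<noteq> {}" "finite B" "B \<noteq> {}"
  shows "hausdorff_dist m A B \<le> r \<longleftrightarrow>
    (\<forall>a\<in>A. \<exists>b\<in>B. mdist m a b \<le> r) \<and> (\<forall>b\<in>B. \<exists>a\<in>A. mdist m a b \<le> r)"
  using assms by (simp add: hausdorff_dist_def cSup_eq_Max cInf_eq_Min Min_le_iff)

lemma mcball_hausdorff_graph_metric: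
  assumes "connected_graph V E" "finite A" "A \<noteq> {}" "A \<subseteq> V"
  shows "mcball_of (hausdorff_metric (graph_metric V E)) A r =
    {B. finite B \<and> B \<subseteq> (\<Union>a\<in>A. mcball_of (graph_metric V E) a r) \<and>
        (\<forall>a\<in>A. B \<inter> mcball_of (graph_metric V E) a r \<noteq> {})}"
  (is "?L = ?R")
proof (intro set_eqI iffI)
  let ?m = "graph_metric V E"
  have nc: "nonempty_compacts ?m = {A. A \<noteq> {} \<and> finite A \<and> A \<subseteq> V}"
    by (rule nonempty_compacts_graph_metric[OF assms(1)])
  have A: "A \<in> nonempty_compacts ?m"
    using assms nc by simp
  {
    fix B assume "B \<in> ?L"
    then have B: "B \<in> nonempty_compacts ?m" and le: "hausdorff_dist ?m A B \<le> r"
      using A by (auto simp: mdist_hausdorff_metric)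
    from B have B': "finite B" "B \<noteq> {}" "B \<subseteq> V"
      using nc by auto
    have "\<forall>a\<in>A. \<exists>b\<in>B. mdist ?m a b \<le> r" "\<forall>b\<in>B. \<exists>a\<in>A. mdist ?m a b \<le> r"
      using le hausdorff_dist_le_iff[OF assms(2,3) B'(1,2)] by blast+
    then show "B \<in> ?R"
      using B' assms(1,4) by (simp add: subset_iff disjoint_iff) blast
  next
    fix B assume R: "B \<in> ?R"
    then have B: "finite B" "B \<noteq> {}" "B \<subseteq> V"
      using assms(1,3) by auto
    then have "B \<in> nonempty_compacts ?m"
      using nc by simp
    moreover have "\<forall>a\<in>A. \<exists>b\<in>B. mdist ?m a b \<le> r" "\<forall>b\<in>B. \<exists>a\<in>A. mdist ?m a b \<le> r"
      using R assms(1) by (auto simp: subset_iff disjoint_iff)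
    then have "hausdorff_dist ?m A B \<le> r"
      using hausdorff_dist_le_iff[OF assms(2,3) B(1,2)] by blast
    ultimately show "B \<in> ?L"
      using A by (simp add: mdist_hausdorff_metric)
  }
qed

lemma finite_mcball_hausdorff_graph_metric:
  assumes "connected_graph V E" "locally_finite_graph V E" "finite A" "A \<noteq> {}" "A \<subseteq> V"
  shows "finite (mcball_of (hausdorff_metric (graph_metric V E)) A r)"
proof -
  have "finite (\<Union>a\<in>A. mcball_of (graph_metric V E) a r)"
    using assms finite_mcball_graph_metric[OF assms(1,2)] by blast
  then have "finite (Pow (\<Union>a\<in>A. mcball_of (graph_metric V E) a r))"
    by simp
  then show ?thesis
    unfolding mcball_hausdorff_graph_metric[OF assms(1,3-5)]
    by (rule finite_subset[rotated]) auto
qed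

lemma mcball_hausdorff_graph_metric_1:
  assumes "simple_graph V E" "connected_graph V E" "locally_finite_graph V E"
    "finite A" "A \<noteq> {}" "A \<subseteq> V"
  shows "mcball_of (hausdorff_metric (graph_metric V E)) A 1 =
    {B. B \<subseteq> \<Union>(closed_neighbourhood E ` A) \<and> (\<forall>X\<in>closed_neighbourhood E ` A. B \<inter> X \<noteq> {})}"
proof -
  have "mcball_of (graph_metric V E) a 1 = closed_neighbourhood E a" if "a \<in> A" for a
    using assms(6) that by (intro mcball_graph_metric_1[OF assms(1,2)]) auto
  moreover have "finite (\<Union>(closed_neighbourhood E ` A))"
    using assms by (auto simp: closed_neighbourhood_def locally_finite_graph_def)
  ultimately show ?thesis
    unfolding mcball_hausdorff_graph_metric[OF assms(2,4-6)] by (auto intro: finite_subset)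
qed

lemma card_mcball_hausdorff_singleton:
  assumes "simple_graph V E" "connected_graph V E" "locally_finite_graph V E" "v \<in> V"
  shows "card (mcball_of (hausdorff_metric (graph_metric V E)) {v} 1) =
    2 ^ Suc (vertex_degree E v) - 1"
proof -
  have "mcball_of (hausdorff_metric (graph_metric V E)) {v} 1 =
      Pow (closed_neighbourhood E v) - {{}}"
    using mcball_hausdorff_graph_metric_1[OF assms(1-3), of "{v}"] assms(4) by auto
  moreover have "finite (closed_neighbourhood E v)"
    using assms by (auto simp: closed_neighbourhood_def locally_finite_graph_def)
  ultimately show ?thesis
    using card_closed_neighbourhood[OF assms(1,3,4)]
    by (simp add: card_Diff_singleton card_Pow)
qed

text \<open>Positive degrees give every closed neighbourhood the two elements that the count of hitting
  sets requires.\<close>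

lemma small_mcball_hausdorff_subset:
  assumes "simple_graph V E" "infinite V" "connected_graph V E" "locally_finite_graph V E"
    and A: "finite A" "A \<noteq> {}" "A \<subseteq> V"
    and small: "card (mcball_of (hausdorff_metric (graph_metric V E)) A 1) <
      2 ^ Suc (min_degree V E)"
  shows "A \<subseteq> {v \<in> V. vertex_degree E v = min_degree V E}"
proof
  fix a assume a: "a \<in> A"
  let ?F = "closed_neighbourhood E ` A"
  have V: "b \<in> V" if "b \<in> A" for b
    using A that by auto
  obtain v where "v \<in> V" "vertex_degree E v = min_degree V E"
    using min_degree_attained[of V E] A by blast
  then have "0 < min_degree V E"
    using vertex_degree_pos[OF assms(2-4)] by metis
  then have "2 \<le> Suc (min_degree V E)"
    by simp
  moreover have "finite (\<Union>?F)"
    using A assms(4) by (auto simp: closed_neighbourhood_def locally_finite_graph_def)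
  moreover have "Suc (min_degree V E) \<le> card X" if "X \<in> ?F" for X
    using that V card_closed_neighbourhood[OF assms(1,4)] min_degree_le[of _ V E] by auto
  moreover have "card {B. B \<subseteq> \<Union>?F \<and> (\<forall>X\<in>?F. B \<inter> X \<noteq> {})} < 2 ^ Suc (min_degree V E)"
    using small mcball_hausdorff_graph_metric_1[OF assms(1,3,4) A] by simp
  ultimately have "card (closed_neighbourhood E a) = Suc (min_degree V E)"
    using a by (intro few_hitting_sets[of ?F]) auto
  then show "a \<in> {v \<in> V. vertex_degree E v = min_degree V E}"
    using V[OF a] card_closed_neighbourhood[OF assms(1,4)] by simp
qed


section \<open>Plasticity of the graph and of its hyperspace\<close>

theorem corollary6p5:
  fixes V :: "'a set" and E :: "'a set set" and k :: nat
  assumes "simple_graph V E"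
    and "infinite V"
    and "connected_graph V E"
    and "locally_finite_graph V E"
    and "k = min_degree V E"
    and "finite {v \<in> V. vertex_degree E v = k}"
  shows "plastic (graph_metric V E) \<and> plastic (hausdorff_metric (graph_metric V E))"
proof
  let ?m = "graph_metric V E" and ?h = "hausdorff_metric (graph_metric V E)"
  obtain v where v: "v \<in> V" "vertex_degree E v = k"
    using min_degree_attained[of V E] assms(2,5) by (metis finite.emptyI)
  have "card (mcball_of ?m u 1) = Suc (vertex_degree E u)" if "u \<in> V" for u
    using mcball_graph_metric_1[OF assms(1,3) that] card_closed_neighbourhood[OF assms(1,4) that]
    by simp
  then have "{u \<in> mspace ?m. card (mcball_of ?m u 1) \<le> Suc k} = {u \<in> V. vertex_degree E u = k}"
    using assms(3,5) min_degree_le[of _ V E] by (force intro: le_antisym)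
  then show "plastic ?m"
    using v assms(3,6) finite_mcball_graph_metric[OF assms(3,4)]
    by (intro plastic_if_finite_small_balls[where r = 1 and n = "Suc k"]) auto
  have space: "mspace ?h = {A. A \<noteq> {} \<and> finite A \<and> A \<subseteq> V}"
    by (simp add: nonempty_compacts_graph_metric[OF assms(3)])
  define S where "S = {A \<in> mspace ?h. card (mcball_of ?h A 1) \<le> 2 ^ Suc k - 1}"
  have "{v} \<in> S"
    using v card_mcball_hausdorff_singleton[OF assms(1,3,4) v(1)] space by (simp add: S_def)
  moreover have "S \<subseteq> Pow {u \<in> V. vertex_degree E u = k}"
  proof
    fix A assume "A \<in> S"
    then have A: "finite A" "A \<noteq> {}" "A \<subseteq> V" "card (mcball_of ?h A 1) \<le> 2 ^ Suc k - 1"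
      using space by (auto simp: S_def)
    have "(0::nat) < 2 ^ Suc k"
      by simp
    with A(4) have "card (mcball_of ?h A 1) < 2 ^ Suc (min_degree V E)"
      unfolding assms(5) by linarith
    from small_mcball_hausdorff_subset[OF assms(1-4) A(1-3) this]
    show "A \<in> Pow {u \<in> V. vertex_degree E u = k}"
      using assms(5) by simp
  qed
  then have "finite S"
    using assms(6) by (meson finite_Pow_iff finite_subset)
  moreover have "finite (mcball_of ?h A r)" if "A \<in> mspace ?h" for A r
    using that space finite_mcball_hausdorff_graph_metric[OF assms(3,4)] by auto
  ultimately show "plastic ?h"
    unfolding S_def by (intro plastic_if_finite_small_balls[where r = 1 and n = "2 ^ Suc k - 1"]) auto
qed

end
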